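(* Let $D$ be a finite distributive lattice whose unit element $1$ is join-irreducible. Then $Q = J^{+}(D)$ is representable; that is, there is a finite lattice $L$ and a lattice isomorphism $\psi \colon \operatorname{Con} L \to D$ such that $\psi(\operatorname{Princ} L) = J^{+}(D)$.
   Context: An element $a$ of a finite lattice is join-irreducible if $a \neq 0$ and $a = x \vee y$ implies $a = x$ or $a = y$. For a finite lattice $K$, $J(K)$ is the set of join-irreducible elements of $K$ and $J^{+}(K) = \{0,1\} \cup J(K)$. For a finite lattice $L$, $\operatorname{Con} L$ denotes the congruence lattice of $L$. For $a,b \in L$, $\operatorname{con}(a,b)$ denotes the smallest congruence of $L$ under which $a$ and $b$ are congruent; congruences of this form are called principal. $\operatorname{Princ} L \subseteq \operatorname{Con} L$ denotes the set of all principal congruences of $L$. A subset $Q$ of a finite distributive lattice $D$ is (principal congruence) representable if there is a finite lattice $L$ and an isomorphism $\psi \colon \operatorname{Con} L \to D$ with $\psi(\operatorname{Princ} L) = Q$. *)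

theory Defs
  imports "HOL-Algebra.Lattice"
begin

text \<open>
  Lattices are non-empty, as usual; the locale \<^locale>\<open>lattice\<close> alone admits an
  empty carrier.
\<close>

locale finite_lattice = lattice +
  assumes finite_carrier: "finite (carrier L)"
    and carrier_nonempty: "carrier L \<noteq> {}"

locale finite_distributive_lattice = finite_lattice +
  assumes meet_join_distrib:
    "\<lbrakk>x \<in> carrier L; y \<in> carrier L; z \<in> carrier L\<rbrakk> \<Longrightarrow>
      x \<sqinter> (y \<squnion> z) = (x \<sqinter> y) \<squnion> (x \<sqinter> z)"

definition join_irreducible :: "('a, 'b) gorder_scheme \<Rightarrow> 'a \<Rightarrow> bool" where
  "join_irreducible K a \<longleftrightarrow>
    a \<in> carrier K \<and> a \<noteq> \<bottom>\<^bsub>K\<^esub> \<and>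
    (\<forall>x\<in>carrier K. \<forall>y\<in>carrier K. a = x \<squnion>\<^bsub>K\<^esub> y \<longrightarrow> a = x \<or> a = y)"

definition J :: "('a, 'b) gorder_scheme \<Rightarrow> 'a set" where
  "J K = {a. join_irreducible K a}"

definition J_plus :: "('a, 'b) gorder_scheme \<Rightarrow> 'a set" where
  "J_plus K = {\<bottom>\<^bsub>K\<^esub>, \<top>\<^bsub>K\<^esub>} \<union> J K"

definition congruence :: "('a, 'b) gorder_scheme \<Rightarrow> ('a \<times> 'a) set \<Rightarrow> bool" where
  "congruence L \<theta> \<longleftrightarrow>
    equiv (carrier L) \<theta> \<and>
    (\<forall>a b c d. (a, b) \<in> \<theta> \<longrightarrow> (c, d) \<in> \<theta> \<longrightarrow>
      (a \<squnion>\<^bsub>L\<^esub> c, b \<squnion>\<^bsub>L\<^esub> d) \<in> \<theta> \<and> (a \<sqinter>\<^bsub>L\<^esub> c, b \<sqinter>\<^bsub>L\<^esub> d) \<in> \<theta>)"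

definition Con :: "('a, 'b) gorder_scheme \<Rightarrow> ('a \<times> 'a) set gorder" where
  "Con L = \<lparr>carrier = {\<theta>. congruence L \<theta>}, eq = (=), le = (\<subseteq>)\<rparr>"

definition con :: "('a, 'b) gorder_scheme \<Rightarrow> 'a \<Rightarrow> 'a \<Rightarrow> ('a \<times> 'a) set" where
  "con L a b = (THE \<theta>. least (Con L) \<theta> {\<phi> \<in> carrier (Con L). (a, b) \<in> \<phi>})"

definition Princ :: "('a, 'b) gorder_scheme \<Rightarrow> ('a \<times> 'a) set set" where
  "Princ L = {con L a b | a b. a \<in> carrier L \<and> b \<in> carrier L}"

definition lattice_isomorphism ::
    "('a, 'c) gorder_scheme \<Rightarrow> ('b, 'd) gorder_scheme \<Rightarrow> ('a \<Rightarrow> 'b) \<Rightarrow> bool" where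
  "lattice_isomorphism X Y f \<longleftrightarrow>
    bij_betw f (carrier X) (carrier Y) \<and> join_pres X Y f \<and> meet_pres X Y f"

text \<open>
  Every finite lattice is isomorphic to one whose elements are natural numbers, so
  letting \<open>L\<close> range over the finite lattices on sets of naturals loses nothing.
\<close>

definition principal_congruence_representable ::
    "('a, 'b) gorder_scheme \<Rightarrow> 'a set \<Rightarrow> bool" where
  "principal_congruence_representable D Q \<longleftrightarrow>
    (\<exists>(L :: nat gorder) \<psi>. finite_lattice L \<and>
      lattice_isomorphism (Con L) D \<psi> \<and> \<psi> ` Princ L = Q)"

text \<open>The definite description in \<^const>\<open>con\<close> is well defined.\<close>

lemma (in lattice) congruence_Inter:
  assumes "A \<noteq> {}" and "\<And>\<theta>. \<theta> \<in> A \<Longrightarrow> congruence L \<theta>"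
  shows "congruence L (\<Inter>A)"
  unfolding congruence_def
proof (intro conjI allI impI)
  have A: "equiv (carrier L) \<theta>" if "\<theta> \<in> A" for \<theta>
    using assms(2)[OF that] by (simp add: congruence_def)
  show "equiv (carrier L) (\<Inter>A)"
  proof (rule equivI)
    show "\<Inter>A \<subseteq> carrier L \<times> carrier L"
      using A assms(1) unfolding equiv_def by blast
    show "refl_on (carrier L) (\<Inter>A)"
      using A unfolding equiv_def refl_on_def by blast
    show "sym (\<Inter>A)"
      using A unfolding equiv_def by (meson InterE InterI symD symI)
    show "trans (\<Inter>A)"
      using A unfolding equiv_def by (meson InterE InterI transD transI)
  qed
next
  fix a b c d assume "(a, b) \<in> \<Inter>A" "(c, d) \<in> \<Inter>A"
  then show "(a \<squnion> c, b \<squnion> d) \<in> \<Inter>A" "(a \<sqinter> c, b \<sqinter> d) \<in> \<Inter>A"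
    using assms(2) unfolding congruence_def by blast+
qed

lemma (in lattice) congruence_total: "congruence L (carrier L \<times> carrier L)"
  unfolding congruence_def equiv_def by (auto simp: refl_on_def sym_def trans_def)

lemma (in lattice) least_con:
  assumes "a \<in> carrier L" "b \<in> carrier L"
  shows "least (Con L) (con L a b) {\<phi> \<in> carrier (Con L). (a, b) \<in> \<phi>}"
  unfolding con_def
proof (rule theI')
  let ?S = "{\<phi> \<in> carrier (Con L). (a, b) \<in> \<phi>}"
  have "carrier L \<times> carrier L \<in> ?S"
    using assms congruence_total by (simp add: Con_def)
  then have "congruence L (\<Inter>?S)"
    by (intro congruence_Inter) (auto simp: Con_def)
  then have "least (Con L) (\<Inter>?S) ?S"
    by (auto simp: least_def Con_def)
  then show "\<exists>!\<theta>. least (Con L) \<theta> ?S"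
    by (rule ex1I) (auto simp: least_def Con_def)
qed

end

theory Submission
  imports Defs
begin

text \<open>
  Let \<open>Q\<close> be the poset of join-irreducible elements of \<open>D\<close> other than \<open>1\<close>, and let \<open>U\<close>
  consist of three further indices, incomparable to everything else. The lattice \<open>F\<close> consists
  of vectors with entries at most \<open>2\<close> on \<open>Q\<close> and at most \<open>1\<close> on \<open>U\<close> whose support is a
  chain and where an entry \<open>2\<close> forces the nonzero entries below it to be \<open>2\<close>, together with a
  unit. It is closed under pointwise minima. The atoms from \<open>U\<close> make every congruence that
  moves \<open>0\<close> or \<open>1\<close> total, so a proper congruence only relates vectors with the same
  support. It is determined by the down-set of those colours \<open>p\<close> for which \<open>1\<close> and \<open>2\<close> are
  identified in coordinate \<open>p\<close>. Hence the congruences of \<open>F\<close> are these down-sets plus a new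
  unit, which is \<open>D\<close>. A pair of distinct vectors with the same support differs in a chain of
  colours, so it generates the congruence of the largest one: this is where chain supports
  keep joins of incomparable colours from being principal.
\<close>

section \<open>Lattice isomorphisms and congruences\<close>

lemma (in upper_semilattice) join_eqI:
  assumes "x \<in> carrier L" "y \<in> carrier L" "z \<in> carrier L" "x \<sqsubseteq> z" "y \<sqsubseteq> z"
    and "\<And>w. \<lbrakk>w \<in> carrier L; x \<sqsubseteq> w; y \<sqsubseteq> w\<rbrakk> \<Longrightarrow> z \<sqsubseteq> w"
  shows "x \<squnion> y = z"
  using assms by (intro le_antisym join_le) (auto simp: join_left join_right)

lemma (in lower_semilattice) meet_eqI:
  assumes "x \<in> carrier L" "y \<in> carrier L" "z \<in> carrier L" "z \<sqsubseteq> x" "z \<sqsubseteq> y"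
    and "\<And>w. \<lbrakk>w \<in> carrier L; w \<sqsubseteq> x; w \<sqsubseteq> y\<rbrakk> \<Longrightarrow> w \<sqsubseteq> z"
  shows "x \<sqinter> y = z"
  using assms by (intro le_antisym meet_le) (auto simp: meet_left meet_right)

lemma latticeI:
  assumes "partial_order K"
    and "\<And>x y. \<lbrakk>x \<in> carrier K; y \<in> carrier K\<rbrakk> \<Longrightarrow> \<exists>z\<in>carrier K. x \<sqsubseteq>\<^bsub>K\<^esub> z \<and> y \<sqsubseteq>\<^bsub>K\<^esub> z \<and>
      (\<forall>w\<in>carrier K. x \<sqsubseteq>\<^bsub>K\<^esub> w \<longrightarrow> y \<sqsubseteq>\<^bsub>K\<^esub> w \<longrightarrow> z \<sqsubseteq>\<^bsub>K\<^esub> w)"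
    and "\<And>x y. \<lbrakk>x \<in> carrier K; y \<in> carrier K\<rbrakk> \<Longrightarrow> \<exists>z\<in>carrier K. z \<sqsubseteq>\<^bsub>K\<^esub> x \<and> z \<sqsubseteq>\<^bsub>K\<^esub> y \<and>
      (\<forall>w\<in>carrier K. w \<sqsubseteq>\<^bsub>K\<^esub> x \<longrightarrow> w \<sqsubseteq>\<^bsub>K\<^esub> y \<longrightarrow> w \<sqsubseteq>\<^bsub>K\<^esub> z)"
  shows "lattice K"
proof -
  interpret partial_order K by fact
  show ?thesis
  proof
    fix x y assume xy: "x \<in> carrier K" "y \<in> carrier K"
    obtain u where "u \<in> carrier K" "x \<sqsubseteq>\<^bsub>K\<^esub> u" "y \<sqsubseteq>\<^bsub>K\<^esub> u"
      "\<forall>w\<in>carrier K. x \<sqsubseteq>\<^bsub>K\<^esub> w \<longrightarrow> y \<sqsubseteq>\<^bsub>K\<^esub> w \<longrightarrow> u \<sqsubseteq>\<^bsub>K\<^esub> w"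
      using assms(2)[OF xy] by blast
    then have "least K u (Upper K {x, y})"
      using xy by (simp add: least_def Upper_def)
    then show "\<exists>s. least K s (Upper K {x, y})" ..
    obtain l where "l \<in> carrier K" "l \<sqsubseteq>\<^bsub>K\<^esub> x" "l \<sqsubseteq>\<^bsub>K\<^esub> y"
      "\<forall>w\<in>carrier K. w \<sqsubseteq>\<^bsub>K\<^esub> x \<longrightarrow> w \<sqsubseteq>\<^bsub>K\<^esub> y \<longrightarrow> w \<sqsubseteq>\<^bsub>K\<^esub> l"
      using assms(3)[OF xy] by blast
    then have "greatest K l (Lower K {x, y})"
      using xy by (simp add: greatest_def Lower_def)
    then show "\<exists>s. greatest K s (Lower K {x, y})" ..
  qed
qed

text \<open>Used twice: to copy a finite lattice onto natural numbers, and to obtain the lattice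
  structure of a congruence lattice from its order isomorphism with \<open>D\<close>. Joins of
  congruences therefore never have to be computed.\<close>

lemma order_iso_lattice:
  assumes "lattice X" "partial_order Y"
    and bij: "bij_betw f (carrier X) (carrier Y)"
    and le: "\<And>x y. \<lbrakk>x \<in> carrier X; y \<in> carrier X\<rbrakk> \<Longrightarrow> f x \<sqsubseteq>\<^bsub>Y\<^esub> f y \<longleftrightarrow> x \<sqsubseteq>\<^bsub>X\<^esub> y"
  shows "lattice Y" "lattice_isomorphism X Y f"
proof -
  interpret X: lattice X by fact
  have car: "carrier Y = f ` carrier X"
    using bij by (simp add: bij_betw_def)
  show "lattice Y"
  proof (rule latticeI)
    fix u v assume "u \<in> carrier Y" "v \<in> carrier Y"
    then obtain x y where xy: "x \<in> carrier X" "y \<in> carrier X" "u = f x" "v = f y"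
      using car by auto
    show "\<exists>z\<in>carrier Y. u \<sqsubseteq>\<^bsub>Y\<^esub> z \<and> v \<sqsubseteq>\<^bsub>Y\<^esub> z \<and>
        (\<forall>w\<in>carrier Y. u \<sqsubseteq>\<^bsub>Y\<^esub> w \<longrightarrow> v \<sqsubseteq>\<^bsub>Y\<^esub> w \<longrightarrow> z \<sqsubseteq>\<^bsub>Y\<^esub> w)"
      using xy car
      by (intro bexI[of _ "f (x \<squnion>\<^bsub>X\<^esub> y)"]) (auto simp: le X.join_left X.join_right intro: X.join_le)
    show "\<exists>z\<in>carrier Y. z \<sqsubseteq>\<^bsub>Y\<^esub> u \<and> z \<sqsubseteq>\<^bsub>Y\<^esub> v \<and>
        (\<forall>w\<in>carrier Y. w \<sqsubseteq>\<^bsub>Y\<^esub> u \<longrightarrow> w \<sqsubseteq>\<^bsub>Y\<^esub> v \<longrightarrow> w \<sqsubseteq>\<^bsub>Y\<^esub> z)"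
      using xy car
      by (intro bexI[of _ "f (x \<sqinter>\<^bsub>X\<^esub> y)"]) (auto simp: le X.meet_left X.meet_right intro: X.meet_le)
  qed fact
  then interpret Y: lattice Y .
  have "f (x \<squnion>\<^bsub>X\<^esub> y) = f x \<squnion>\<^bsub>Y\<^esub> f y" if "x \<in> carrier X" "y \<in> carrier X" for x y
    using that car
    by (intro Y.join_eqI[symmetric]) (auto simp: le X.join_left X.join_right intro: X.join_le)
  moreover have "f (x \<sqinter>\<^bsub>X\<^esub> y) = f x \<sqinter>\<^bsub>Y\<^esub> f y" if "x \<in> carrier X" "y \<in> carrier X" for x y
    using that car
    by (intro Y.meet_eqI[symmetric]) (auto simp: le X.meet_left X.meet_right intro: X.meet_le)
  ultimately show "lattice_isomorphism X Y f"
    unfolding lattice_isomorphism_def join_pres_def meet_pres_def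
    using bij X.lattice_axioms Y.lattice_axioms by blast
qed

lemma lattice_isomorphism_inv_into:
  assumes "lattice_isomorphism X Y f"
  shows "lattice_isomorphism Y X (inv_into (carrier X) f)"
proof -
  let ?g = "inv_into (carrier X) f"
  have bij: "bij_betw f (carrier X) (carrier Y)"
    and J: "join_pres X Y f" and M: "meet_pres X Y f"
    using assms by (auto simp: lattice_isomorphism_def)
  interpret X: lattice X using J by (simp add: join_pres_def)
  interpret Y: lattice Y using J by (simp add: join_pres_def)
  have g: "?g u \<in> carrier X" "f (?g u) = u" if "u \<in> carrier Y" for u
    using that bij by (auto simp: bij_betw_def inv_into_into f_inv_into_f)
  have gf: "?g (f x) = x" if "x \<in> carrier X" for x
    using that bij by (simp add: bij_betw_def)
  have "?g (u \<squnion>\<^bsub>Y\<^esub> v) = ?g u \<squnion>\<^bsub>X\<^esub> ?g v" if "u \<in> carrier Y" "v \<in> carrier Y" for u v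
    using J g[OF that(1)] g[OF that(2)] gf[of "?g u \<squnion>\<^bsub>X\<^esub> ?g v"] by (simp add: join_pres_def)
  moreover have "?g (u \<sqinter>\<^bsub>Y\<^esub> v) = ?g u \<sqinter>\<^bsub>X\<^esub> ?g v" if "u \<in> carrier Y" "v \<in> carrier Y" for u v
    using M g[OF that(1)] g[OF that(2)] gf[of "?g u \<sqinter>\<^bsub>X\<^esub> ?g v"] by (simp add: meet_pres_def)
  ultimately show ?thesis
    unfolding lattice_isomorphism_def join_pres_def meet_pres_def
    using bij_betw_inv_into[OF bij] X.lattice_axioms Y.lattice_axioms by blast
qed

section \<open>Congruences and their transport along isomorphisms\<close>

lemma partial_order_Con: "partial_order (Con L)"
  by unfold_locales (auto simp: Con_def)

lemma (in lattice) con_eqI: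
  assumes "a \<in> carrier L" "b \<in> carrier L" "congruence L \<theta>" "(a, b) \<in> \<theta>"
    and "\<And>\<phi>. \<lbrakk>congruence L \<phi>; (a, b) \<in> \<phi>\<rbrakk> \<Longrightarrow> \<theta> \<subseteq> \<phi>"
  shows "con L a b = \<theta>"
  using least_con[OF assms(1,2)] assms(3-) by (auto simp: least_def Con_def)

lemma congruence_subset:
  assumes "congruence L \<theta>" shows "\<theta> \<subseteq> carrier L \<times> carrier L"
  using assms by (simp add: congruence_def equiv_def)

lemma congruence_image:
  assumes iso: "lattice_isomorphism X Y f" and \<theta>: "congruence X \<theta>"
  shows "congruence Y (map_prod f f ` \<theta>)"
proof -
  have bij: "bij_betw f (carrier X) (carrier Y)"
    and J: "join_pres X Y f" and M: "meet_pres X Y f"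
    using iso by (auto simp: lattice_isomorphism_def)
  have inj: "inj_on f (carrier X)" and car: "carrier Y = f ` carrier X"
    using bij by (auto simp: bij_betw_def)
  have eq: "refl_on (carrier X) \<theta>" "sym \<theta>" "trans \<theta>" "\<theta> \<subseteq> carrier X \<times> carrier X"
    using \<theta> by (auto simp: congruence_def equiv_def)
  show ?thesis
    unfolding congruence_def
  proof (intro conjI allI impI equivI)
    show "map_prod f f ` \<theta> \<subseteq> carrier Y \<times> carrier Y"
      using eq(4) car by auto
    show "refl_on (carrier Y) (map_prod f f ` \<theta>)"
      using eq(1) car by (auto simp: refl_on_def)
    show "sym (map_prod f f ` \<theta>)"
      using eq(2) by (auto simp: sym_def)
    show "trans (map_prod f f ` \<theta>)"
    proof (rule transI)
      fix u v w assume "(u, v) \<in> map_prod f f ` \<theta>" "(v, w) \<in> map_prod f f ` \<theta>"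
      then obtain x y y' z where *: "(x, y) \<in> \<theta>" "(y', z) \<in> \<theta>" "u = f x" "v = f y" "f y = f y'" "w = f z"
        by auto
      then have "y = y'"
        using inj eq(4) by (auto dest: inj_onD)
      then have "(x, z) \<in> \<theta>"
        using * eq(3) by (auto dest: transD)
      then show "(u, w) \<in> map_prod f f ` \<theta>"
        using * by force
    qed
  next
    fix a b c d assume "(a, b) \<in> map_prod f f ` \<theta>" "(c, d) \<in> map_prod f f ` \<theta>"
    then obtain x y z w where *: "(x, y) \<in> \<theta>" "(z, w) \<in> \<theta>" "a = f x" "b = f y" "c = f z" "d = f w"
      by auto
    then have "x \<in> carrier X" "y \<in> carrier X" "z \<in> carrier X" "w \<in> carrier X"
      using eq(4) by auto
    then have "(a \<squnion>\<^bsub>Y\<^esub> c, b \<squnion>\<^bsub>Y\<^esub> d) = map_prod f f (x \<squnion>\<^bsub>X\<^esub> z, y \<squnion>\<^bsub>X\<^esub> w)"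
      "(a \<sqinter>\<^bsub>Y\<^esub> c, b \<sqinter>\<^bsub>Y\<^esub> d) = map_prod f f (x \<sqinter>\<^bsub>X\<^esub> z, y \<sqinter>\<^bsub>X\<^esub> w)"
      using J M * by (auto simp: join_pres_def meet_pres_def)
    moreover have "(x \<squnion>\<^bsub>X\<^esub> z, y \<squnion>\<^bsub>X\<^esub> w) \<in> \<theta>" "(x \<sqinter>\<^bsub>X\<^esub> z, y \<sqinter>\<^bsub>X\<^esub> w) \<in> \<theta>"
      using \<theta> * by (auto simp: congruence_def)
    ultimately show "(a \<squnion>\<^bsub>Y\<^esub> c, b \<squnion>\<^bsub>Y\<^esub> d) \<in> map_prod f f ` \<theta>"
      "(a \<sqinter>\<^bsub>Y\<^esub> c, b \<sqinter>\<^bsub>Y\<^esub> d) \<in> map_prod f f ` \<theta>"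
      by (metis imageI)+
  qed
qed

lemma map_prod_inv_into_image:
  assumes "inj_on f A" "\<theta> \<subseteq> A \<times> A"
  shows "map_prod (inv_into A f) (inv_into A f) ` map_prod f f ` \<theta> = \<theta>"
proof -
  have "map_prod (inv_into A f) (inv_into A f) (map_prod f f p) = p" if "p \<in> \<theta>" for p
    using assms that by (cases p) auto
  then show ?thesis
    by (simp add: image_image)
qed

lemma map_prod_image_inv_into:
  assumes "\<phi> \<subseteq> f ` A \<times> f ` A"
  shows "map_prod f f ` map_prod (inv_into A f) (inv_into A f) ` \<phi> = \<phi>"
proof -
  have "map_prod f f (map_prod (inv_into A f) (inv_into A f) p) = p" if "p \<in> \<phi>" for p
    using assms that by (cases p) (auto simp: f_inv_into_f)
  then show ?thesis
    by (simp add: image_image)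
qed

text \<open>Pushing forward along the inverse isomorphism undoes pushing forward along
  \<open>f\<close>, because congruences lie inside the squares of the carriers.\<close>

lemma Con_image:
  assumes iso: "lattice_isomorphism X Y f"
  shows "bij_betw ((`) (map_prod f f)) (carrier (Con X)) (carrier (Con Y))"
    and "(`) (map_prod f f) ` Princ X = Princ Y"
proof -
  let ?A = "carrier X"
  let ?g = "inv_into ?A f"
  have bij: "bij_betw f ?A (carrier Y)"
    and lat: "lattice X" "lattice Y"
    using iso by (auto simp: lattice_isomorphism_def join_pres_def)
  have inj: "inj_on f ?A" and car: "carrier Y = f ` ?A"
    using bij by (auto simp: bij_betw_def)
  interpret X: lattice X by fact
  interpret Y: lattice Y by fact
  note gcong = congruence_image[OF lattice_isomorphism_inv_into[OF iso]]
  note gf = map_prod_inv_into_image[OF inj congruence_subset]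
  have fg: "map_prod f f ` map_prod ?g ?g ` \<phi> = \<phi>" if "congruence Y \<phi>" for \<phi>
    using map_prod_image_inv_into[of \<phi> f ?A] congruence_subset[OF that] car by simp
  show "bij_betw ((`) (map_prod f f)) (carrier (Con X)) (carrier (Con Y))"
    by (rule bij_betw_byWitness[where f' = "(`) (map_prod ?g ?g)"])
      (auto simp: Con_def gf fg gcong congruence_image[OF iso])
  have con: "con Y (f a) (f b) = map_prod f f ` con X a b" if ab: "a \<in> ?A" "b \<in> ?A" for a b
  proof (rule Y.con_eqI)
    have X: "congruence X (con X a b)" "(a, b) \<in> con X a b"
      and Xleast: "\<And>\<phi>. congruence X \<phi> \<Longrightarrow> (a, b) \<in> \<phi> \<Longrightarrow> con X a b \<subseteq> \<phi>"
      using X.least_con[OF ab] by (auto simp: least_def Con_def)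
    show "congruence Y (map_prod f f ` con X a b)"
      by (rule congruence_image[OF iso X(1)])
    show "(f a, f b) \<in> map_prod f f ` con X a b"
      using X(2) by force
    fix \<phi> assume \<phi>: "congruence Y \<phi>" "(f a, f b) \<in> \<phi>"
    \<comment> \<open>Minimality is known in \<open>X\<close> only: a congruence of \<open>Y\<close>
      is pulled back, compared there with \<open>con X a b\<close>, and pushed forward
      again.\<close>
    have "map_prod ?g ?g (f a, f b) \<in> map_prod ?g ?g ` \<phi>"
      using \<phi>(2) by (rule imageI)
    then have "(a, b) \<in> map_prod ?g ?g ` \<phi>"
      using ab inj by simp
    then have "con X a b \<subseteq> map_prod ?g ?g ` \<phi>"
      by (rule Xleast[OF gcong[OF \<phi>(1)]])
    then show "map_prod f f ` con X a b \<subseteq> \<phi>"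
      using fg[OF \<phi>(1)] by (metis image_mono)
  qed (use ab car in auto)
  show "(`) (map_prod f f) ` Princ X = Princ Y"
  proof (intro equalityI subsetI)
    fix \<theta> assume "\<theta> \<in> (`) (map_prod f f) ` Princ X"
    then obtain a b where ab: "a \<in> ?A" "b \<in> ?A" "\<theta> = map_prod f f ` con X a b"
      by (auto simp: Princ_def)
    then have "\<theta> = con Y (f a) (f b)" by (simp add: con)
    then show "\<theta> \<in> Princ Y"
      using ab car by (auto simp: Princ_def)
  next
    fix \<theta> assume "\<theta> \<in> Princ Y"
    then obtain a b where ab: "a \<in> ?A" "b \<in> ?A" "\<theta> = con Y (f a) (f b)"
      by (auto simp: Princ_def car)
    then have "\<theta> = map_prod f f ` con X a b" by (simp add: con)
    then show "\<theta> \<in> (`) (map_prod f f) ` Princ X"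
      using ab by (auto simp: Princ_def)
  qed
qed

text \<open>Representability asks for a lattice of natural numbers and a map out of its congruence
  lattice. It is more convenient to work with a finite lattice of any type and an order isomorphism
  from \<open>D\<close> onto its congruences: the lattice is copied along an injection into
  \<open>nat\<close>, and the map is inverted at the end.\<close>

lemma principal_congruence_representableI:
  fixes L :: "('c, 'd) gorder_scheme" and D :: "('a, 'b) gorder_scheme"
  assumes L: "finite_lattice L" and D: "lattice D"
    and bij: "bij_betw f (carrier D) (carrier (Con L))"
    and le: "\<And>x y. \<lbrakk>x \<in> carrier D; y \<in> carrier D\<rbrakk> \<Longrightarrow> f x \<subseteq> f y \<longleftrightarrow> x \<sqsubseteq>\<^bsub>D\<^esub> y"
    and Q: "Q \<subseteq> carrier D" "f ` Q = Princ L"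
  shows "principal_congruence_representable D Q"
proof -
  interpret L: finite_lattice L by fact
  obtain e :: "'c \<Rightarrow> nat" where e: "inj_on e (carrier L)"
    using finite_imp_inj_to_nat_seg[OF L.finite_carrier] by blast
  let ?g = "inv_into (carrier L) e"
  define N :: "nat gorder" where
    "N = \<lparr>carrier = e ` carrier L, eq = (=), le = \<lambda>x y. ?g x \<sqsubseteq>\<^bsub>L\<^esub> ?g y\<rparr>"
  have N: "partial_order N"
  proof
    fix u v w assume u: "u \<in> carrier N" and v: "v \<in> carrier N"
    show "u .=\<^bsub>N\<^esub> v" if "u \<sqsubseteq>\<^bsub>N\<^esub> v" "v \<sqsubseteq>\<^bsub>N\<^esub> u"
      using u v that e L.le_antisym[of "?g u" "?g v"] by (auto simp: N_def)
    show "u \<sqsubseteq>\<^bsub>N\<^esub> w" if "w \<in> carrier N" "u \<sqsubseteq>\<^bsub>N\<^esub> v" "v \<sqsubseteq>\<^bsub>N\<^esub> w"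
      using u v that e L.le_trans[of "?g u" "?g v" "?g w"] by (auto simp: N_def)
  qed (use e in \<open>auto simp: N_def\<close>)
  have eN: "bij_betw e (carrier L) (carrier N)"
    using e by (simp add: N_def bij_betw_def)
  have leN: "e x \<sqsubseteq>\<^bsub>N\<^esub> e y \<longleftrightarrow> x \<sqsubseteq>\<^bsub>L\<^esub> y" if "x \<in> carrier L" "y \<in> carrier L" for x y
    using that e by (simp add: N_def)
  have lat: "lattice N" and iso: "lattice_isomorphism L N e"
    using order_iso_lattice[OF L.lattice_axioms N eN leN] by blast+
  interpret N: lattice N by fact
  have finite: "finite_lattice N"
    by unfold_locales (auto simp: N_def L.finite_carrier L.carrier_nonempty)
  define h where "h = (`) (map_prod e e) \<circ> f"
  have h: "bij_betw h (carrier D) (carrier (Con N))"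
    unfolding h_def by (rule bij_betw_trans[OF bij Con_image(1)[OF iso]])
  have inj2: "inj_on (map_prod e e) (carrier L \<times> carrier L)"
    using map_prod_inj_on[OF e e] .
  have sub: "f x \<subseteq> carrier L \<times> carrier L" if "x \<in> carrier D" for x
    using bij that by (auto simp: bij_betw_def Con_def dest!: congruence_subset)
  have "h x \<sqsubseteq>\<^bsub>Con N\<^esub> h y \<longleftrightarrow> x \<sqsubseteq>\<^bsub>D\<^esub> y" if "x \<in> carrier D" "y \<in> carrier D" for x y
  proof -
    have "map_prod e e ` f x \<subseteq> map_prod e e ` f y \<longleftrightarrow> (\<forall>p\<in>f x. map_prod e e p \<in> map_prod e e ` f y)"
      by (rule image_subset_iff)
    also have "\<dots> \<longleftrightarrow> f x \<subseteq> f y"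
      unfolding subset_eq using sub[OF that(1)]
      by (intro ball_cong refl inj_on_image_mem_iff[OF inj2 _ sub[OF that(2)]]) blast
    finally show ?thesis
      using le[OF that] by (simp add: h_def Con_def)
  qed
  then have "lattice_isomorphism D (Con N) h"
    by (rule order_iso_lattice(2)[OF D partial_order_Con h])
  then have "lattice_isomorphism (Con N) D (inv_into (carrier D) h)"
    by (rule lattice_isomorphism_inv_into)
  moreover have "inv_into (carrier D) h ` Princ N = Q"
  proof -
    have "Princ N = h ` Q"
      unfolding h_def using Con_image(2)[OF iso] Q(2) by (simp only: image_comp[symmetric])
    then show ?thesis
      using Q(1) h by (simp add: bij_betw_def inv_into_image_cancel)
  qed
  ultimately show ?thesis
    unfolding principal_congruence_representable_def using finite by blast
qed

lemma (in finite_lattice) finite_lattice_top: "weak_partial_order_top L"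
proof
  have "least L (\<Squnion>(carrier L)) (Upper L (carrier L))"
    by (intro finite_sup_least) (simp_all add: finite_carrier carrier_nonempty)
  then show "\<exists>x. greatest L x (carrier L)"
    by (auto simp: least_def greatest_def Upper_def)
qed

lemma (in finite_lattice) finite_lattice_bottom: "weak_partial_order_bottom L"
proof
  have "greatest L (\<Sqinter>(carrier L)) (Lower L (carrier L))"
    by (intro finite_inf_greatest) (simp_all add: finite_carrier carrier_nonempty)
  then show "\<exists>x. least L x (carrier L)"
    by (auto simp: least_def greatest_def Lower_def)
qed

text \<open>Meets are preserved by assumption. For joins, \<open>a\<close> lies below
  \<open>j a = j b\<close> and hence below \<open>j\<close> of the join of \<open>b\<close> and
  \<open>d\<close>, and so does \<open>c\<close>; applying \<open>j\<close> to the resulting bound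
  and using idempotence gives one inequality, and the other is symmetric.\<close>

lemma (in lattice) congruence_kernel_closure:
  assumes closed: "\<And>x. x \<in> carrier L \<Longrightarrow> j x \<in> carrier L"
    and ext: "\<And>x. x \<in> carrier L \<Longrightarrow> x \<sqsubseteq> j x"
    and idem: "\<And>x. x \<in> carrier L \<Longrightarrow> j (j x) = j x"
    and meet: "\<And>x y. \<lbrakk>x \<in> carrier L; y \<in> carrier L\<rbrakk> \<Longrightarrow> j (x \<sqinter> y) = j x \<sqinter> j y"
  shows "congruence L {(x, y). x \<in> carrier L \<and> y \<in> carrier L \<and> j x = j y}"
proof -
  have mono: "j x \<sqsubseteq> j y" if "x \<in> carrier L" "y \<in> carrier L" "x \<sqsubseteq> y" for x y
    using that meet[of x y] closed by (simp add: le_iff_join)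
  have join_le: "j (a \<squnion> c) \<sqsubseteq> j (b \<squnion> d)"
    if "a \<in> carrier L" "b \<in> carrier L" "c \<in> carrier L" "d \<in> carrier L" "j a = j b" "j c = j d"
    for a b c d
  proof -
    have "a \<sqsubseteq> j (b \<squnion> d)"
      using that ext[of a] mono[of b "b \<squnion> d"] by (simp add: join_left closed le_trans[of a "j b"])
    moreover have "c \<sqsubseteq> j (b \<squnion> d)"
      using that ext[of c] mono[of d "b \<squnion> d"] by (simp add: join_right closed le_trans[of c "j d"])
    ultimately have "a \<squnion> c \<sqsubseteq> j (b \<squnion> d)"
      using that by (intro join_le) (auto simp: closed)
    then have "j (a \<squnion> c) \<sqsubseteq> j (j (b \<squnion> d))"
      using that by (intro mono) (auto simp: closed)
    then show ?thesis
      using that by (simp add: idem)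
  qed
  then have join: "j (a \<squnion> c) = j (b \<squnion> d)"
    if "a \<in> carrier L" "b \<in> carrier L" "c \<in> carrier L" "d \<in> carrier L" "j a = j b" "j c = j d"
    for a b c d
    using that by (intro le_antisym) (auto simp: closed)
  show ?thesis
    unfolding congruence_def
    by (auto simp: join meet equiv_def refl_on_def sym_def trans_def)
qed

section \<open>A lattice of coloured vectors\<close>

text \<open>The upper bounds of two elements form a finite set, non-empty because of
  \<open>t\<close>, and the meet of this set is the join. This spares a formula for joins in
  \<open>F\<close>.\<close>

lemma (in lower_semilattice) lattice_if_finite_top:
  assumes "finite (carrier L)" "t \<in> carrier L" "\<And>x. x \<in> carrier L \<Longrightarrow> x \<sqsubseteq> t"
  shows "lattice L"
proof
  fix x y assume xy: "x \<in> carrier L" "y \<in> carrier L"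
  let ?S = "Upper L {x, y}"
  have S: "finite ?S" "?S \<subseteq> carrier L" "?S \<noteq> {}"
    using assms xy by (auto simp: Upper_def intro: finite_subset)
  then have inf: "greatest L (\<Sqinter>?S) (Lower L ?S)"
    by (rule finite_inf_greatest)
  then have "x \<sqsubseteq> \<Sqinter>?S" "y \<sqsubseteq> \<Sqinter>?S"
    using xy by (auto simp: greatest_def Lower_def Upper_def)
  then have "least L (\<Sqinter>?S) ?S"
    using inf S(2) xy by (auto simp: least_def greatest_def Lower_def Upper_def)
  then show "\<exists>s. least L s ?S" ..
qed

text \<open>Comparability is also demanded for \<open>i = j\<close>, which supplies
  \<open>r x x\<close> when the inserted \<open>x\<close> becomes the greatest element. The lemma
  will be applied to the coordinates in which two vectors differ.\<close>

lemma finite_chain_has_greatest: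
  assumes "finite S" "S \<noteq> {}"
    and "\<And>i j. \<lbrakk>i \<in> S; j \<in> S\<rbrakk> \<Longrightarrow> r i j \<or> r j i"
    and "\<And>i j k. \<lbrakk>r i j; r j k\<rbrakk> \<Longrightarrow> r i k"
  shows "\<exists>p\<in>S. \<forall>i\<in>S. r i p"
  using assms(1-3)
proof (induction rule: finite_ne_induct)
  case (singleton x)
  then show ?case by blast
next
  case (insert x S)
  then obtain p where p: "p \<in> S" "\<forall>i\<in>S. r i p"
    by blast
  show ?case
  proof (cases "r x p")
    case True
    then show ?thesis using p by blast
  next
    case False
    then have "r p x" "r x x"
      using insert.prems p(1) by blast+
    then show ?thesis
      using p assms(4) by blast
  qed
qed

text \<open>With three elements in \<open>U\<close>, at least two remain after any index is removed.
  By \<open>r_Q\<close> and \<open>disjoint\<close>, an element of \<open>U\<close> is comparable to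
  no other index. These two facts drive \<open>cong_null\<close> and
  \<open>cong_full\<close>.\<close>

locale colored_lattice =
  fixes Q U :: "'i set" and r :: "'i \<Rightarrow> 'i \<Rightarrow> bool"
  assumes finite_Q: "finite Q" and finite_U: "finite U" and card_U: "3 \<le> card U"
    and disjoint: "Q \<inter> U = {}"
    and r_Q: "r i j \<Longrightarrow> i \<in> Q \<and> j \<in> Q"
    and r_refl: "i \<in> Q \<Longrightarrow> r i i"
    and r_trans: "\<lbrakk>r i j; r j k\<rbrakk> \<Longrightarrow> r i k"
begin

text \<open>The value 0 outside \<open>Q\<close> and \<open>U\<close> confines all supports of
  proper vectors to a finite set, so that \<open>F\<close> is finite although its elements are
  functions.\<close>

definition cap :: "'i \<Rightarrow> nat" where
  "cap i = (if i \<in> Q then 2 else if i \<in> U then 1 else 0)"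

definition proper :: "('i \<Rightarrow> nat) \<Rightarrow> bool" where
  "proper x \<longleftrightarrow> (\<forall>i. x i \<le> cap i) \<and>
    (\<forall>i j. x i \<noteq> 0 \<longrightarrow> x j \<noteq> 0 \<longrightarrow> i = j \<or> r i j \<or> r j i) \<and>
    (\<forall>i j. r i j \<longrightarrow> x i \<noteq> 0 \<longrightarrow> x j = 2 \<longrightarrow> x i = 2)"

text \<open>The value is 2 on \<open>U\<close> as well, where proper vectors have entries at most 1.
  The unit is thus a new vector, yet it is pointwise above all others, so order and meets in
  \<open>F\<close> are pointwise without exception.\<close>

definition full :: "'i \<Rightarrow> nat" where
  "full = (\<lambda>_. 2)"

definition null :: "'i \<Rightarrow> nat" where
  "null = (\<lambda>_. 0)"

definition single :: "'i \<Rightarrow> nat \<Rightarrow> 'i \<Rightarrow> nat" where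
  "single i k = (\<lambda>j. if j = i then k else 0)"

definition F :: "('i \<Rightarrow> nat) gorder" where
  "F = \<lparr>carrier = insert full (Collect proper), eq = (=), le = (\<le>)\<rparr>"

lemma carrier_F: "carrier F = insert full (Collect proper)"
  and le_F [simp]: "x \<sqsubseteq>\<^bsub>F\<^esub> y \<longleftrightarrow> x \<le> y"
  by (simp_all add: F_def)

lemma full_carrier [simp]: "full \<in> carrier F"
  by (simp add: carrier_F)

lemma properI: "\<lbrakk>x \<in> carrier F; x \<noteq> full\<rbrakk> \<Longrightarrow> proper x"
  by (simp add: carrier_F)

lemma proper_carrier: "proper x \<Longrightarrow> x \<in> carrier F"
  by (simp add: carrier_F)

lemma cap_le: "cap i \<le> 2"
  by (simp add: cap_def)

lemma proper_cap: "proper x \<Longrightarrow> x i \<le> cap i"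
  by (simp add: proper_def)

lemma proper_comparable: "\<lbrakk>proper x; x i \<noteq> 0; x j \<noteq> 0\<rbrakk> \<Longrightarrow> i = j \<or> r i j \<or> r j i"
  by (simp add: proper_def)

lemma proper_eq_2_below: "\<lbrakk>proper x; r i j; x i \<noteq> 0; x j = 2\<rbrakk> \<Longrightarrow> x i = 2"
  by (simp add: proper_def)

lemma le2: "x \<in> carrier F \<Longrightarrow> x i \<le> 2"
  using order_trans[OF proper_cap cap_le, of x i] by (auto simp: carrier_F full_def)

lemma le_full: "x \<in> carrier F \<Longrightarrow> x \<le> full"
  by (simp add: le_fun_def full_def le2)

lemma proper_U: "\<lbrakk>proper x; u \<in> U\<rbrakk> \<Longrightarrow> x u \<le> 1"
  using disjoint proper_cap[of x u] by (auto simp: cap_def split: if_splits)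

lemma proper_support: "\<lbrakk>proper x; x i \<noteq> 0\<rbrakk> \<Longrightarrow> i \<in> Q \<union> U"
  using proper_cap[of x i] by (auto simp: cap_def split: if_splits)

lemma proper_eq_2: "\<lbrakk>proper x; x i = 2\<rbrakk> \<Longrightarrow> i \<in> Q"
  using proper_support[of x i] proper_U[of x i] by auto

lemma U_nonempty: "\<exists>u. u \<in> U"
  using card_U by (metis card.empty equals0I not_numeral_le_zero)

lemma not_proper_full [simp]: "\<not> proper full"
  using U_nonempty proper_U[of full] by (auto simp: full_def)

lemma proper_null [simp]: "proper null"
  by (simp add: proper_def null_def)

lemma null_le: "null \<le> x"
  by (simp add: null_def le_fun_def)

lemma null_carrier [simp]: "null \<in> carrier F"
  by (simp add: proper_carrier)

lemma proper_single: "k \<le> cap i \<Longrightarrow> proper (single i k)"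
  by (auto simp: proper_def single_def)

lemma single_Q [simp]: "p \<in> Q \<Longrightarrow> k \<le> 2 \<Longrightarrow> single p k \<in> carrier F"
  by (simp add: proper_carrier proper_single cap_def)

lemma single_1 [simp]: "i \<in> Q \<union> U \<Longrightarrow> single i 1 \<in> carrier F"
  by (rule proper_carrier, rule proper_single) (auto simp: cap_def)

lemma finite_F: "finite (carrier F)"
proof -
  have "Collect proper \<subseteq> {x. \<forall>i. (i \<in> Q \<union> U \<longrightarrow> x i \<in> {0..2}) \<and> (i \<notin> Q \<union> U \<longrightarrow> x i = 0)}"
    using proper_support le2 proper_carrier by fastforce
  moreover have "finite {x. \<forall>i. (i \<in> Q \<union> U \<longrightarrow> x i \<in> {0..2::nat}) \<and> (i \<notin> Q \<union> U \<longrightarrow> x i = 0)}"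
    by (rule finite_set_of_finite_funs) (simp_all add: finite_Q finite_U)
  ultimately show ?thesis
    by (simp add: carrier_F finite_subset)
qed

text \<open>The support of a minimum lies in both supports, and a minimum of value 2 means that both
  entries are 2, so each condition is inherited from the two vectors.\<close>

lemma proper_min:
  assumes "proper x" "proper y" shows "proper (\<lambda>i. min (x i) (y i))"
proof -
  have "min (x i) (y i) \<le> cap i" for i
    using proper_cap[OF assms(1), of i] by (simp add: min_le_iff_disj)
  moreover have "i = j \<or> r i j \<or> r j i" if "min (x i) (y i) \<noteq> 0" "min (x j) (y j) \<noteq> 0" for i j
    using that proper_comparable[OF assms(1), of i j] by auto
  moreover have "min (x i) (y i) = 2" if "r i j" "min (x i) (y i) \<noteq> 0" "min (x j) (y j) = 2" for i j
  proof -
    have "x j = 2" "y j = 2"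
      using that(3) assms[THEN proper_cap, of j] cap_le[of j] by linarith+
    then have "x i = 2" "y i = 2"
      using that(1,2) assms[THEN proper_eq_2_below, of i j] by auto
    then show ?thesis by simp
  qed
  ultimately show ?thesis
    by (simp add: proper_def)
qed

lemma min_full: "x \<in> carrier F \<Longrightarrow> (\<lambda>i. min (x i) (full i)) = x" "x \<in> carrier F \<Longrightarrow> (\<lambda>i. min (full i) (x i)) = x"
  using le2 by (auto simp: full_def fun_eq_iff min_absorb1 min_absorb2)

lemma min_carrier: "\<lbrakk>x \<in> carrier F; y \<in> carrier F\<rbrakk> \<Longrightarrow> (\<lambda>i. min (x i) (y i)) \<in> carrier F"
  by (cases "x = full"; cases "y = full") (auto simp: min_full intro!: proper_carrier proper_min dest: properI)

lemma lattice_F: "lattice F"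
proof -
  have po: "partial_order F"
    by unfold_locales (auto simp: F_def)
  then interpret F: partial_order F .
  have "lower_semilattice F"
  proof
    fix x y assume xy: "x \<in> carrier F" "y \<in> carrier F"
    then have "greatest F (\<lambda>i. min (x i) (y i)) (Lower F {x, y})"
      using min_carrier by (auto simp: greatest_def Lower_def le_fun_def)
    then show "\<exists>s. greatest F s (Lower F {x, y})" by blast
  qed
  then interpret F: lower_semilattice F .
  show ?thesis
    using F.lattice_if_finite_top[OF finite_F full_carrier] le_full by simp
qed

sublocale F: finite_lattice F
  by (intro finite_lattice.intro finite_lattice_axioms.intro lattice_F finite_F) (auto simp: carrier_F)

lemma meet_F: "\<lbrakk>x \<in> carrier F; y \<in> carrier F\<rbrakk> \<Longrightarrow> x \<sqinter>\<^bsub>F\<^esub> y = (\<lambda>i. min (x i) (y i))"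
  by (rule F.meet_eqI) (auto simp: min_carrier le_fun_def)

text \<open>Joins in \<open>F\<close> are not pointwise, since a pointwise maximum may violate the
  conditions on proper vectors. This lower bound is what is used about them in general.\<close>

lemma join_F_ge:
  assumes "x \<in> carrier F" "y \<in> carrier F"
  shows "x i \<le> (x \<squnion>\<^bsub>F\<^esub> y) i" "y i \<le> (x \<squnion>\<^bsub>F\<^esub> y) i"
  using F.join_left[OF assms] F.join_right[OF assms] by (auto simp: le_fun_def)

text \<open>The join has the incomparable indices \<open>i\<close> and \<open>j\<close> in its
  support, so it cannot be proper.\<close>

lemma join_eq_full:
  assumes "x \<in> carrier F" "y \<in> carrier F" "x i \<noteq> 0" "y j \<noteq> 0" "\<not> (i = j \<or> r i j \<or> r j i)"
  shows "x \<squnion>\<^bsub>F\<^esub> y = full"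
proof (rule ccontr)
  assume "x \<squnion>\<^bsub>F\<^esub> y \<noteq> full"
  then have "proper (x \<squnion>\<^bsub>F\<^esub> y)"
    using assms by (intro properI) auto
  moreover have "(x \<squnion>\<^bsub>F\<^esub> y) i \<noteq> 0" "(x \<squnion>\<^bsub>F\<^esub> y) j \<noteq> 0"
    using join_F_ge[OF assms(1,2), of i] join_F_ge[OF assms(1,2), of j] assms(3,4) by auto
  ultimately show False
    using assms(5) unfolding proper_def by blast
qed

lemma null_join: "x \<in> carrier F \<Longrightarrow> null \<squnion>\<^bsub>F\<^esub> x = x"
  by (rule F.join_eqI) (auto simp: null_le)

section \<open>The congruences attached to down-sets of colours\<close>

text \<open>For a down-set \<open>I\<close> this is a closure operator, and \<open>raise I x\<close>
  is the greatest element of the \<open>theta I\<close>-class of \<open>x\<close>.\<close>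

definition raise :: "'i set \<Rightarrow> ('i \<Rightarrow> nat) \<Rightarrow> 'i \<Rightarrow> nat" where
  "raise I x = (\<lambda>i. if i \<in> I \<and> x i \<noteq> 0 then 2 else x i)"

definition theta :: "'i set \<Rightarrow> (('i \<Rightarrow> nat) \<times> ('i \<Rightarrow> nat)) set" where
  "theta I = {(x, y). x \<in> carrier F \<and> y \<in> carrier F \<and> raise I x = raise I y}"

definition downset :: "'i set \<Rightarrow> bool" where
  "downset I \<longleftrightarrow> I \<subseteq> Q \<and> (\<forall>i j. r i j \<longrightarrow> j \<in> I \<longrightarrow> i \<in> I)"

lemma raise_full: "raise I full = full"
  by (auto simp: raise_def full_def)

text \<open>Supports do not change, and \<open>I\<close> lies in \<open>Q\<close>, where 2 is
  allowed. If an entry \<open>j\<close> has been raised, then every \<open>i\<close> below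
  \<open>j\<close> is also in \<open>I\<close>, so a nonzero entry there is raised too; this is
  where being a down-set matters.\<close>

lemma proper_raise:
  assumes "downset I" "proper x" shows "proper (raise I x)"
proof -
  have "raise I x i \<le> cap i" for i
    using assms(1) proper_cap[OF assms(2), of i] by (auto simp: raise_def downset_def cap_def)
  moreover have "i = j \<or> r i j \<or> r j i" if "raise I x i \<noteq> 0" "raise I x j \<noteq> 0" for i j
  proof -
    have "x i \<noteq> 0" "x j \<noteq> 0"
      using that by (auto simp: raise_def split: if_splits)
    then show ?thesis
      using assms(2) by (simp add: proper_def)
  qed
  moreover have "raise I x i = 2" if "r i j" "raise I x i \<noteq> 0" "raise I x j = 2" for i j
  proof -
    have "x i \<noteq> 0" "x j = 2 \<or> j \<in> I"
      using that by (auto simp: raise_def split: if_splits)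
    then show ?thesis
      using assms that(1) by (auto simp: raise_def proper_def downset_def)
  qed
  ultimately show ?thesis
    by (simp add: proper_def)
qed

lemma raise_carrier: "\<lbrakk>downset I; x \<in> carrier F\<rbrakk> \<Longrightarrow> raise I x \<in> carrier F"
  by (auto simp: carrier_F raise_full proper_raise)

lemma congruence_theta:
  assumes "downset I" shows "congruence F (theta I)"
  unfolding theta_def
proof (rule F.congruence_kernel_closure)
  show "raise I x \<in> carrier F" if "x \<in> carrier F" for x
    using that by (rule raise_carrier[OF assms])
  show "x \<sqsubseteq>\<^bsub>F\<^esub> raise I x" if "x \<in> carrier F" for x
    using le2[OF that] by (auto simp: le_fun_def raise_def)
  show "raise I (raise I x) = raise I x" for x
    by (auto simp: raise_def)
  show "raise I (x \<sqinter>\<^bsub>F\<^esub> y) = raise I x \<sqinter>\<^bsub>F\<^esub> raise I y" if "x \<in> carrier F" "y \<in> carrier F" for x y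
    using that le2[OF that(1)] le2[OF that(2)] raise_carrier[OF assms]
    by (auto simp: meet_F raise_def fun_eq_iff min_absorb1 min_absorb2)
qed

text \<open>This pair is the probe for the colour \<open>p\<close>: it recovers \<open>I\<close>
  from \<open>theta I\<close> and is the model for \<open>colors\<close> below.\<close>

lemma single_theta: "p \<in> Q \<Longrightarrow> (single p 1, single p 2) \<in> theta I \<longleftrightarrow> p \<in> I"
proof -
  have "raise I (single p 1) = raise I (single p 2) \<longleftrightarrow> p \<in> I"
    by (auto simp: raise_def single_def fun_eq_iff)
  then show "p \<in> Q \<Longrightarrow> ?thesis"
    by (simp add: theta_def)
qed

lemma theta_mono: "I \<subseteq> I' \<Longrightarrow> theta I \<subseteq> theta I'"
  unfolding theta_def raise_def fun_eq_iff by (clarsimp split: if_splits) (metis subsetD zero_neq_numeral)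

lemma theta_subset_iff: "I \<subseteq> Q \<Longrightarrow> theta I \<subseteq> theta I' \<longleftrightarrow> I \<subseteq> I'"
  using theta_mono single_theta by (meson subset_eq)

lemma null_full_theta: "(null, full) \<notin> theta I"
  by (auto simp: theta_def raise_def null_def full_def fun_eq_iff)

lemma theta_not_total: "\<not> carrier F \<times> carrier F \<subseteq> theta I"
  using null_full_theta full_carrier null_carrier by blast

lemma proper_raise_U: "\<lbrakk>I \<subseteq> Q; proper x; u \<in> U\<rbrakk> \<Longrightarrow> raise I x u \<le> 1"
  using disjoint proper_U[of x u] by (auto simp: raise_def)

text \<open>Raising colours in \<open>Q\<close> leaves the entries of a proper vector on
  \<open>U\<close> at most 1, whereas \<open>full\<close> has 2 there. Hence \<open>full\<close> is
  alone in its class.\<close>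

lemma theta_full:
  assumes "I \<subseteq> Q" "(x, y) \<in> theta I" "x = full \<or> y = full" shows "x = y"
proof (rule ccontr)
  assume "x \<noteq> y"
  then have "proper x \<and> y = full \<or> proper y \<and> x = full"
    using assms(2,3) by (auto simp: theta_def intro: properI)
  moreover obtain u where u: "u \<in> U"
    using U_nonempty ..
  moreover have "raise I x u = raise I y u"
    using assms(2) by (simp add: theta_def)
  moreover have "raise I full u = 2"
    unfolding raise_full by (simp add: full_def)
  ultimately show False
    using proper_raise_U[OF assms(1) _ u, of x] proper_raise_U[OF assms(1) _ u, of y] by auto
qed

lemma U_avoiding: "\<exists>u v. u \<in> U \<and> v \<in> U \<and> u \<noteq> v \<and> u \<noteq> i \<and> v \<noteq> i"
proof -
  have "2 \<le> card (U - {i})"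
    using card_U card_Diff_singleton_if[of U i] by auto
  then obtain A where "A \<subseteq> U - {i}" "card A = 2"
    by (rule obtain_subset_with_card_n)
  then show ?thesis
    by (auto simp: card_2_iff)
qed

lemma U_incomparable: "\<lbrakk>u \<in> U; i \<noteq> u\<rbrakk> \<Longrightarrow> \<not> (i = u \<or> r i u \<or> r u i)"
  using r_Q disjoint by blast

lemma single_apply: "single i k i = k" "j \<noteq> i \<Longrightarrow> single i k j = 0"
  by (simp_all add: single_def)

section \<open>Classification of the congruences of \<open>F\<close>\<close>

context
  fixes \<phi> assumes \<phi>: "congruence F \<phi>"
begin

lemma cong_carrier: "(x, y) \<in> \<phi> \<Longrightarrow> x \<in> carrier F \<and> y \<in> carrier F"
  using congruence_subset[OF \<phi>] by auto

lemma cong_refl: "x \<in> carrier F \<Longrightarrow> (x, x) \<in> \<phi>"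
  using \<phi> by (auto simp: congruence_def equiv_def refl_on_def)

lemma cong_sym: "(x, y) \<in> \<phi> \<Longrightarrow> (y, x) \<in> \<phi>"
  using \<phi> by (auto simp: congruence_def equiv_def dest: symD)

lemma cong_trans: "\<lbrakk>(x, y) \<in> \<phi>; (y, z) \<in> \<phi>\<rbrakk> \<Longrightarrow> (x, z) \<in> \<phi>"
  using \<phi> by (auto simp: congruence_def equiv_def dest: transD)

lemma cong_meet: "\<lbrakk>(x, y) \<in> \<phi>; z \<in> carrier F\<rbrakk> \<Longrightarrow> (x \<sqinter>\<^bsub>F\<^esub> z, y \<sqinter>\<^bsub>F\<^esub> z) \<in> \<phi>"
  using \<phi> cong_refl by (auto simp: congruence_def)

lemma cong_join: "\<lbrakk>(x, y) \<in> \<phi>; z \<in> carrier F\<rbrakk> \<Longrightarrow> (x \<squnion>\<^bsub>F\<^esub> z, y \<squnion>\<^bsub>F\<^esub> z) \<in> \<phi>"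
  using \<phi> cong_refl by (auto simp: congruence_def)

lemma cong_convex:
  assumes "(x, z) \<in> \<phi>" "y \<in> carrier F" "x \<le> y" "y \<le> z" shows "(x, y) \<in> \<phi>"
proof -
  have "x \<sqinter>\<^bsub>F\<^esub> y = x" "z \<sqinter>\<^bsub>F\<^esub> y = y"
    using assms cong_carrier[OF assms(1)] by (auto simp: meet_F fun_eq_iff le_fun_def min_def intro: antisym)
  then show ?thesis
    using cong_meet[OF assms(1,2)] by simp
qed

lemma cong_null_full:
  assumes "(null, full) \<in> \<phi>" shows "\<phi> = carrier F \<times> carrier F"
proof -
  have "(null, x) \<in> \<phi>" if "x \<in> carrier F" for x
    using cong_convex[OF assms that] le_full[OF that] null_le by blast
  then have "(x, y) \<in> \<phi>" if "x \<in> carrier F" "y \<in> carrier F" for x y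
    using that cong_trans[OF cong_sym, of null x y] by simp
  then show ?thesis
    using congruence_subset[OF \<phi>] by auto
qed

text \<open>Let \<open>i\<close> be in the support of \<open>x\<close>, and let \<open>u\<close>,
  \<open>v\<close> be two other indices from \<open>U\<close>. Joining the pair with the atom of
  \<open>u\<close> or of \<open>v\<close> relates that atom to \<open>full\<close>. Meeting the
  relation for \<open>u\<close> with the atom of \<open>v\<close> relates \<open>null\<close> to
  that atom, and hence to \<open>full\<close>.\<close>

lemma cong_null:
  assumes "(null, x) \<in> \<phi>" "x \<noteq> null" shows "\<phi> = carrier F \<times> carrier F"
proof -
  have x: "x \<in> carrier F"
    using cong_carrier[OF assms(1)] by blast
  obtain i where i: "x i \<noteq> 0"
    using assms(2) by (auto simp: null_def)
  obtain u v where uv: "u \<in> U" "v \<in> U" "u \<noteq> v" "u \<noteq> i" "v \<noteq> i"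
    using U_avoiding by metis
  have *: "(single w 1, full) \<in> \<phi>" if "w \<in> U" "w \<noteq> i" for w
  proof -
    have w: "single w 1 \<in> carrier F"
      using that(1) by (intro single_1) blast
    have "x \<squnion>\<^bsub>F\<^esub> single w 1 = full"
      using x w i U_incomparable[OF that(1), of i] that(2)
      by (intro join_eq_full[of _ _ i w]) (auto simp: single_apply)
    then show ?thesis
      using cong_join[OF assms(1) w] null_join[OF w] by simp
  qed
  have w: "single u 1 \<in> carrier F" "single v 1 \<in> carrier F"
    using single_1[OF UnI2[OF uv(1)]] single_1[OF UnI2[OF uv(2)]] .
  have "single u 1 \<sqinter>\<^bsub>F\<^esub> single v 1 = null"
    using uv(3) w by (auto simp: meet_F single_def null_def)
  then have "(null, single v 1) \<in> \<phi>"
    using cong_meet[OF *[OF uv(1,4)] w(2)] w(2) by (simp add: meet_F min_full)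
  then show ?thesis
    using *[OF uv(2,5)] cong_trans cong_null_full by blast
qed

text \<open>A nonzero proper \<open>x\<close> has some \<open>u\<close> in \<open>U\<close> outside
  its support, since the support is a chain. Meeting with the atom of \<open>u\<close> relates
  \<open>null\<close> to that atom, which reduces the claim to \<open>cong_null\<close>.\<close>

lemma cong_full:
  assumes "(x, full) \<in> \<phi>" "x \<noteq> full" shows "\<phi> = carrier F \<times> carrier F"
proof (cases "x = null")
  case True
  then show ?thesis using assms(1) cong_null_full by simp
next
  case False
  have x: "x \<in> carrier F"
    using cong_carrier[OF assms(1)] by blast
  then have "proper x"
    using assms(2) by (rule properI)
  obtain i where i: "x i \<noteq> 0"
    using False by (auto simp: null_def)
  obtain u where u: "u \<in> U" "u \<noteq> i"
    using U_avoiding by metis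
  then have "x u = 0"
    using proper_comparable[OF \<open>proper x\<close> i, of u] U_incomparable[OF u(1), of i] by auto
  have w: "single u 1 \<in> carrier F"
    using u by (intro single_1) blast
  have "x \<sqinter>\<^bsub>F\<^esub> single u 1 = null"
    using \<open>x u = 0\<close> x w by (auto simp: meet_F single_def null_def)
  then have "(null, single u 1) \<in> \<phi>"
    using cong_meet[OF assms(1) w] w by (simp add: meet_F min_full)
  moreover have "single u 1 \<noteq> null"
    by (auto simp: single_def null_def fun_eq_iff)
  ultimately show ?thesis
    by (rule cong_null)
qed

definition colors :: "'i set" where
  "colors = {p \<in> Q. (single p 1, single p 2) \<in> \<phi>}"

text \<open>
  If \<open>r p q\<close>, joining \<open>single p 1\<close> to \<open>single q 1\<close> leaves entry \<open>p\<close> at \<open>1\<close>, but joining it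
  to \<open>single q 2\<close> forces entry \<open>p\<close> up to \<open>2\<close>.
\<close>

lemma colors_downset: "downset colors"
proof -
  have "p \<in> colors" if q: "q \<in> colors" and pq: "r p q" for p q
  proof (cases "p = q")
    case False
    have Q: "p \<in> Q" "q \<in> Q"
      using pq r_Q by auto
    let ?c = "\<lambda>i. if i = p \<or> i = q then 1 else 0 :: nat"
    let ?x = "single q 1 \<squnion>\<^bsub>F\<^esub> single p 1" and ?y = "single q 2 \<squnion>\<^bsub>F\<^esub> single p 1"
    have car: "single q 1 \<in> carrier F" "single p 1 \<in> carrier F" "single q 2 \<in> carrier F"
      "single p 2 \<in> carrier F" "?x \<in> carrier F" "?y \<in> carrier F"
      using Q by simp_all
    \<comment> \<open>\<open>?c\<close> is an explicit proper upper bound of both single vectors,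
      which pins entry \<open>p\<close> of their join to 1.\<close>
    have "proper ?c"
      using Q pq by (auto simp: proper_def cap_def)
    then have "?x \<le> ?c"
      using F.join_le[of "single q 1" ?c "single p 1"] car
      by (simp add: proper_carrier le_fun_def single_def)
    then have "?x p = 1"
      using join_F_ge(2)[OF car(1,2), of p] by (auto simp: le_fun_def single_def intro: antisym dest: spec[of _ p])
    then have x: "?x \<sqinter>\<^bsub>F\<^esub> single p 2 = single p 1"
      using car by (auto simp: meet_F single_def fun_eq_iff)
    have "?y p = 2"
    proof (cases "?y = full")
      case False
      then have "proper ?y"
        using car by (intro properI)
      moreover have "?y p \<noteq> 0" "?y q = 2"
        using join_F_ge(1)[OF car(3,2), of q] join_F_ge(2)[OF car(3,2), of p] le2[OF car(6), of q]
        by (auto simp: single_apply)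
      ultimately show ?thesis
        using pq by (intro proper_eq_2_below)
    qed (simp add: full_def)
    then have y: "?y \<sqinter>\<^bsub>F\<^esub> single p 2 = single p 2"
      using car by (auto simp: meet_F single_def fun_eq_iff)
    have "(?x, ?y) \<in> \<phi>"
      using q car by (intro cong_join) (simp_all add: colors_def)
    from cong_meet[OF this car(4)] show ?thesis
      using Q by (simp only: x y colors_def) simp
  qed (use q in simp)
  moreover have "colors \<subseteq> Q"
    by (auto simp: colors_def)
  ultimately show ?thesis
    unfolding downset_def by blast
qed

text \<open>Meeting with single vectors isolates one coordinate. An entry growing from 0 would
  relate \<open>null\<close> to an atom, contradicting \<open>cong_null\<close>; so a differing
  entry goes from 1 to 2, and meeting with \<open>single i 2\<close> shows that its index is in
  \<open>colors\<close>.\<close>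

lemma cong_le_raise:
  assumes ntot: "\<phi> \<noteq> carrier F \<times> carrier F" and xy: "(x, y) \<in> \<phi>" "x \<le> y"
  shows "raise colors x = raise colors y"
proof (cases "y = full")
  case True
  then show ?thesis using cong_full xy ntot by metis
next
  case False
  have car: "x \<in> carrier F" "y \<in> carrier F"
    using cong_carrier[OF xy(1)] by auto
  then have y: "proper y"
    using False by (intro properI)
  have le: "x i \<le> y i" for i
    using xy(2) by (simp add: le_fun_def)
  have zero: "y i = 0" if "x i = 0" for i
  proof (rule ccontr)
    assume i: "y i \<noteq> 0"
    then have w: "single i 1 \<in> carrier F"
      using y by (intro single_1 proper_support)
    have "x \<sqinter>\<^bsub>F\<^esub> single i 1 = null" "y \<sqinter>\<^bsub>F\<^esub> single i 1 = single i 1"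
      using w car i that by (auto simp: meet_F single_def null_def fun_eq_iff)
    then have "(null, single i 1) \<in> \<phi>"
      using cong_meet[OF xy(1) w] by simp
    moreover have "single i 1 \<noteq> null"
      by (auto simp: single_def null_def fun_eq_iff)
    ultimately show False
      using cong_null ntot by blast
  qed
  have diff: "i \<in> colors" if "x i \<noteq> y i" for i
  proof -
    have i: "x i = 1" "y i = 2"
      using that le[of i] zero[of i] le2[OF car(2), of i] by linarith+
    then have "i \<in> Q"
      using y by (intro proper_eq_2)
    then have w: "single i 2 \<in> carrier F"
      by simp
    have "x \<sqinter>\<^bsub>F\<^esub> single i 2 = single i 1" "y \<sqinter>\<^bsub>F\<^esub> single i 2 = single i 2"
      using w car i by (auto simp: meet_F single_def fun_eq_iff)
    then show ?thesis
      using cong_meet[OF xy(1) w] \<open>i \<in> Q\<close> by (simp add: colors_def)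
  qed
  have "raise colors x i = raise colors y i" for i
  proof (cases "x i = y i")
    case False
    then have "x i \<noteq> 0" "y i \<noteq> 0"
      using zero[of i] le[of i] by auto
    then show ?thesis
      using diff[OF False] by (simp add: raise_def)
  qed (simp add: raise_def)
  then show ?thesis
    by (rule ext)
qed

text \<open>A maximal \<open>y\<close> above \<open>x\<close> in the class of \<open>x\<close>
  already has entry 2 at every colour in \<open>colors\<close> that lies in the support of
  \<open>x\<close>. It is therefore above \<open>raise colors x\<close>, and convexity
  applies.\<close>

lemma cong_raise:
  assumes x: "x \<in> carrier F" shows "(x, raise colors x) \<in> \<phi>"
proof -
  let ?S = "{y \<in> carrier F. x \<le> y \<and> (x, y) \<in> \<phi>}"
  have "finite ?S" "x \<in> ?S"
    using finite_F x cong_refl by auto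
  then obtain y where y: "y \<in> ?S" and max: "\<forall>z\<in>?S. y \<le> z \<longrightarrow> z = y"
    using finite_has_maximal[of ?S] by blast
  have "y p = 2" if p: "p \<in> colors" "x p \<noteq> 0" for p
  proof -
    have Q: "p \<in> Q" and p12: "(single p 2, single p 1) \<in> \<phi>"
      using p(1) cong_sym by (auto simp: colors_def)
    then have car: "single p 1 \<in> carrier F" "single p 2 \<in> carrier F" "y \<in> carrier F"
      using y by auto
    \<comment> \<open>Since \<open>single p 1\<close> is below \<open>y\<close>, joining the pair of
      single vectors with \<open>y\<close> relates \<open>?z\<close> to \<open>y\<close>; maximality
      then gives equality.\<close>
    let ?z = "single p 2 \<squnion>\<^bsub>F\<^esub> y"
    have "x p \<le> y p"
      using y by (simp add: le_fun_def)
    then have "single p 1 \<le> y"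
      using p(2) by (auto simp: single_def le_fun_def)
    then have "single p 1 \<squnion>\<^bsub>F\<^esub> y = y"
      using car by (intro F.join_eqI) auto
    then have "(?z, y) \<in> \<phi>"
      using cong_join[OF p12 car(3)] by simp
    moreover have "y \<le> ?z"
      using F.join_right[OF car(2,3)] by simp
    ultimately have "?z \<in> ?S" "y \<le> ?z"
      using y cong_trans[OF _ cong_sym, of x y ?z] cong_carrier[of ?z y] by (auto intro: order_trans)
    then have "?z = y"
      using max by blast
    then show ?thesis
      using join_F_ge(1)[OF car(2,3), of p] le2[OF car(3), of p] by (simp add: single_apply)
  qed
  then have "raise colors x \<le> y"
    using y by (auto simp: raise_def le_fun_def)
  moreover have "x \<le> raise colors x"
    using le2[OF x] by (auto simp: raise_def le_fun_def)
  ultimately show ?thesis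
    using y cong_convex[OF _ raise_carrier[OF colors_downset x], of x y] by simp
qed

lemma cong_eq_theta:
  assumes "\<phi> \<noteq> carrier F \<times> carrier F" shows "\<phi> = theta colors"
proof (intro equalityI subrelI)
  fix x y assume xy: "(x, y) \<in> \<phi>"
  then have car: "x \<in> carrier F" "y \<in> carrier F"
    using cong_carrier by auto
  \<comment> \<open>Both vectors are related to their meet, so the comparable case
    \<open>cong_le_raise\<close> suffices.\<close>
  let ?m = "x \<sqinter>\<^bsub>F\<^esub> y"
  have "(?m, y) \<in> \<phi>" "(?m, x) \<in> \<phi>"
    using cong_meet[OF xy car(2)] cong_sym[OF cong_meet[OF xy car(1)]] car
    by (simp_all add: meet_F min.commute)
  then have "raise colors ?m = raise colors x" "raise colors ?m = raise colors y"
    using assms car by (auto intro!: cong_le_raise simp: meet_F le_fun_def)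
  then show "(x, y) \<in> theta colors"
    using car by (simp add: theta_def)
next
  fix x y assume "(x, y) \<in> theta colors"
  then have "(x, raise colors x) \<in> \<phi>" "(raise colors x, y) \<in> \<phi>"
    using cong_raise[of x] cong_sym[OF cong_raise[of y]] by (auto simp: theta_def)
  then show "(x, y) \<in> \<phi>"
    by (rule cong_trans)
qed

lemma cong_cases: "\<phi> = carrier F \<times> carrier F \<or> (\<exists>I. downset I \<and> \<phi> = theta I)"
  using cong_eq_theta colors_downset by blast

end

section \<open>Principal congruences of \<open>F\<close>\<close>

lemma theta_iff_differences:
  assumes "x \<in> carrier F" "y \<in> carrier F" "\<And>i. x i = 0 \<longleftrightarrow> y i = 0"
  shows "(x, y) \<in> theta I \<longleftrightarrow> {i. x i \<noteq> y i} \<subseteq> I"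
proof -
  have "raise I x i = raise I y i \<longleftrightarrow> x i = y i \<or> i \<in> I" for i
    using assms(3)[of i] by (auto simp: raise_def)
  then show ?thesis
    using assms(1,2) unfolding theta_def fun_eq_iff by blast
qed

lemma theta_same_support:
  assumes "(x, y) \<in> theta I" shows "x i = 0 \<longleftrightarrow> y i = 0"
proof -
  have "raise I x i = raise I y i"
    using assms by (simp add: theta_def)
  then show ?thesis
    by (auto simp: raise_def split: if_splits)
qed

lemma downset_below: "downset {i. r i p}"
  using r_Q r_trans by (auto simp: downset_def)

lemma downset_below_subset: "\<lbrakk>downset I; p \<in> I\<rbrakk> \<Longrightarrow> {i. r i p} \<subseteq> I"
  by (auto simp: downset_def)

lemma con_null_full: "con F null full = carrier F \<times> carrier F"
  by (rule F.con_eqI) (auto simp: F.congruence_total dest: cong_null_full)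

lemma con_refl:
  assumes "x \<in> carrier F" shows "con F x x = theta {}"
proof (rule F.con_eqI)
  show "congruence F (theta {})"
    by (rule congruence_theta) (simp add: downset_def)
  fix \<phi> assume "congruence F \<phi>"
  moreover have "theta {} = {(x, y). x \<in> carrier F \<and> x = y}"
    by (auto simp: theta_def raise_def)
  ultimately show "theta {} \<subseteq> \<phi>"
    by (auto simp: cong_refl)
qed (use assms in \<open>auto simp: theta_def\<close>)

text \<open>Any other congruence containing the pair is total or some \<open>theta I\<close>. In the
  latter case the difference at \<open>p\<close> forces \<open>p\<close> into \<open>I\<close>, and
  with it everything below \<open>p\<close>.\<close>

lemma con_eq_theta:
  assumes "(x, y) \<in> theta {i. r i p}" "p \<in> Q" "x p \<noteq> y p"
  shows "con F x y = theta {i. r i p}"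
proof (rule F.con_eqI)
  show car: "x \<in> carrier F" "y \<in> carrier F"
    using assms(1) by (auto simp: theta_def)
  show "congruence F (theta {i. r i p})"
    by (intro congruence_theta downset_below)
  fix \<phi> assume \<phi>: "congruence F \<phi>" "(x, y) \<in> \<phi>"
  from cong_cases[OF \<phi>(1)] show "theta {i. r i p} \<subseteq> \<phi>"
  proof (elim disjE exE conjE)
    fix I assume I: "downset I" "\<phi> = theta I"
    then have "p \<in> I"
      using \<phi>(2) assms(3) theta_iff_differences[OF car theta_same_support[OF assms(1)], of I] by blast
    then show ?thesis
      using I theta_mono downset_below_subset by blast
  qed (auto simp: theta_def)
qed (use assms in simp)

lemma con_single:
  assumes "p \<in> Q" shows "con F (single p 1) (single p 2) = theta {i. r i p}"
proof (rule con_eq_theta)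
  show "(single p 1, single p 2) \<in> theta {i. r i p}"
    unfolding single_theta[OF assms] using r_refl[OF assms] by simp
qed (simp_all add: assms single_apply)

text \<open>The split is whether some \<open>theta I\<close> contains the pair; if none does,
  \<open>cong_cases\<close> leaves only the total congruence.\<close>

lemma con_cases:
  assumes car: "x \<in> carrier F" "y \<in> carrier F" and "x \<noteq> y"
  shows "con F x y = carrier F \<times> carrier F \<or> (\<exists>p\<in>Q. con F x y = theta {i. r i p})"
proof (cases "\<exists>I. downset I \<and> (x, y) \<in> theta I")
  case True
  then obtain I where I: "downset I" "(x, y) \<in> theta I" by blast
  then have IQ: "I \<subseteq> Q" by (simp add: downset_def)
  have "proper x"
    using theta_full[OF IQ I(2)] assms by (auto intro: properI)
  let ?S = "{i. x i \<noteq> y i}"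
  note same = theta_same_support[OF I(2)]
  have SI: "?S \<subseteq> I"
    using theta_iff_differences[OF car same] I(2) by blast
  \<comment> \<open>The supports agree, so the vectors can differ only at indices of the support of
    \<open>x\<close>, which is a chain.\<close>
  have "\<exists>p\<in>?S. \<forall>i\<in>?S. r i p"
  proof (rule finite_chain_has_greatest)
    show "finite ?S" "?S \<noteq> {}"
      using SI IQ finite_Q assms(3) by (auto intro: finite_subset)
    fix i j assume ij: "i \<in> ?S" "j \<in> ?S"
    then have "x i \<noteq> 0" "x j \<noteq> 0"
      using same[of i] same[of j] by auto
    then show "r i j \<or> r j i"
      using proper_comparable[OF \<open>proper x\<close>, of i j] ij SI IQ r_refl by blast
  qed (rule r_trans)
  then obtain p where p: "x p \<noteq> y p" "\<forall>i\<in>?S. r i p"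
    by blast
  then have "(x, y) \<in> theta {i. r i p}"
    using theta_iff_differences[OF car same] by blast
  moreover have "p \<in> Q"
    using p SI IQ by blast
  ultimately show ?thesis
    using con_eq_theta p(1) by blast
next
  case False
  have "con F x y = carrier F \<times> carrier F"
  proof (rule F.con_eqI[OF car F.congruence_total])
    fix \<phi> assume "congruence F \<phi>" "(x, y) \<in> \<phi>"
    then show "carrier F \<times> carrier F \<subseteq> \<phi>"
      using cong_cases False by blast
  qed (use car in simp)
  then show ?thesis ..
qed

end

section \<open>Join-irreducible elements\<close>

lemma (in finite_lattice) finite_lattice_bounded: "bounded_lattice L"
proof -
  interpret t: weak_partial_order_top L by (rule finite_lattice_top)
  interpret b: weak_partial_order_bottom L by (rule finite_lattice_bottom)
  show ?thesis ..
qed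

text \<open>Take \<open>p\<close> minimal among the elements below \<open>d\<close> but not below
  \<open>e\<close>, minimality being measured by the number of elements below. Everything strictly
  below \<open>p\<close> is below \<open>e\<close>, so a join of two such elements is too and cannot
  be \<open>p\<close>.\<close>

lemma (in finite_lattice) join_irreducible_separates:
  assumes "d \<in> carrier L" "e \<in> carrier L" "\<not> d \<sqsubseteq> e"
  shows "\<exists>p. join_irreducible L p \<and> p \<sqsubseteq> d \<and> \<not> p \<sqsubseteq> e"
proof -
  interpret bounded_lattice L by (rule finite_lattice_bounded)
  let ?S = "{x \<in> carrier L. x \<sqsubseteq> d \<and> \<not> x \<sqsubseteq> e}"
  let ?m = "\<lambda>x. card {y \<in> carrier L. y \<sqsubseteq> x}"
  have "d \<in> ?S" using assms by simp
  then obtain p where p: "p \<in> ?S" and min: "\<And>x. x \<in> ?S \<Longrightarrow> ?m p \<le> ?m x"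
    using ex_has_least_nat[of "\<lambda>x. x \<in> ?S" d ?m] by blast
  have below: "x \<sqsubseteq> e" if x: "x \<in> carrier L" "x \<sqsubseteq> p" "x \<noteq> p" for x
  proof (rule ccontr)
    assume "\<not> x \<sqsubseteq> e"
    then have "x \<in> ?S"
      using x p assms(1) le_trans[of x p d] by simp
    moreover have "{y \<in> carrier L. y \<sqsubseteq> x} \<subset> {y \<in> carrier L. y \<sqsubseteq> p}"
    proof
      show "{y \<in> carrier L. y \<sqsubseteq> x} \<subseteq> {y \<in> carrier L. y \<sqsubseteq> p}"
        using x p le_trans[of _ x p] by auto
      show "{y \<in> carrier L. y \<sqsubseteq> x} \<noteq> {y \<in> carrier L. y \<sqsubseteq> p}"
        using x p le_antisym[of x p] by auto
    qed
    then have "?m x < ?m p"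
      using finite_carrier by (intro psubset_card_mono) auto
    ultimately show False
      using min[of x] by simp
  qed
  have "p = x \<or> p = y" if "x \<in> carrier L" "y \<in> carrier L" "p = x \<squnion> y" for x y
  proof (rule ccontr)
    assume "\<not> (p = x \<or> p = y)"
    then have "x \<sqsubseteq> e" "y \<sqsubseteq> e"
      using that below[of x] below[of y] join_left[of x y] join_right[of x y] by auto
    then show False
      using p that assms(2) join_le by simp
  qed
  moreover have "p \<noteq> \<bottom>"
    using p assms(2) bottom_lower by auto
  ultimately show ?thesis
    using p by (auto simp: join_irreducible_def)
qed

text \<open>By distributivity \<open>p\<close> is the join of its meets with \<open>x\<close> and
  \<open>y\<close>, and so equals one of them.\<close>

lemma (in finite_distributive_lattice) join_irreducible_prime:
  assumes p: "join_irreducible L p" and "x \<in> carrier L" "y \<in> carrier L" "p \<sqsubseteq> x \<squnion> y"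
  shows "p \<sqsubseteq> x \<or> p \<sqsubseteq> y"
proof -
  have car: "p \<in> carrier L"
    using p by (simp add: join_irreducible_def)
  then have "p = (p \<sqinter> x) \<squnion> (p \<sqinter> y)"
    using assms meet_join_distrib[of p x y] le_iff_join[of p "x \<squnion> y"] by simp
  then have "p = p \<sqinter> x \<or> p = p \<sqinter> y"
    using p meet_closed[OF car assms(2)] meet_closed[OF car assms(3)]
    unfolding join_irreducible_def by blast
  then show ?thesis
    using car assms by (metis le_iff_join)
qed

text \<open>The witness is the join of \<open>I\<close>, built one element at a time; primeness
  handles each step. It will turn a down-set of colours back into an element of
  \<open>D\<close>.\<close>

lemma (in finite_distributive_lattice) join_of_join_irreducibles:
  assumes "finite I" "\<And>p. p \<in> I \<Longrightarrow> join_irreducible L p"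
  shows "\<exists>d\<in>carrier L. \<forall>q. join_irreducible L q \<longrightarrow> (q \<sqsubseteq> d \<longleftrightarrow> (\<exists>p\<in>I. q \<sqsubseteq> p))"
  using assms
proof (induction I rule: finite_induct)
  case empty
  interpret bounded_lattice L by (rule finite_lattice_bounded)
  have "\<not> q \<sqsubseteq> \<bottom>" if "join_irreducible L q" for q
    using that bottom_lower[of q] le_antisym[of q \<bottom>] by (auto simp: join_irreducible_def)
  then show ?case by auto
next
  case (insert p I)
  then obtain d where d: "d \<in> carrier L"
    "\<And>q. join_irreducible L q \<Longrightarrow> q \<sqsubseteq> d \<longleftrightarrow> (\<exists>p\<in>I. q \<sqsubseteq> p)"
    by blast
  have p: "p \<in> carrier L"
    using insert.prems[of p] by (simp add: join_irreducible_def)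
  have "q \<sqsubseteq> p \<squnion> d \<longleftrightarrow> q \<sqsubseteq> p \<or> q \<sqsubseteq> d" if q: "join_irreducible L q" for q
  proof -
    have "q \<in> carrier L"
      using q by (simp add: join_irreducible_def)
    then show ?thesis
      using join_irreducible_prime[OF q p d(1)] join_left[OF p d(1)] join_right[OF p d(1)]
        le_trans[of q p "p \<squnion> d"] le_trans[of q d "p \<squnion> d"] p d(1) by auto
  qed
  then show ?case
    using d p by (intro bexI[of _ "p \<squnion> d"]) auto
qed

section \<open>The isomorphism between \<open>D\<close> and the congruence lattice\<close>

theorem theorem3:
  fixes D :: "('a, 'b) gorder_scheme"
  assumes "finite_distributive_lattice D"
    and "join_irreducible D \<top>\<^bsub>D\<^esub>"
  shows "principal_congruence_representable D (J_plus D)"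
proof -
  interpret D: finite_distributive_lattice D by fact
  interpret D: bounded_lattice D by (rule D.finite_lattice_bounded)
  \<comment> \<open>The unit of \<open>D\<close> is not a colour: it will correspond to the total
    congruence. The sum type provides indices for \<open>U\<close> outside \<open>Q\<close>.\<close>
  define P where "P = J D - {\<top>\<^bsub>D\<^esub>}"
  define Q where "Q = (Inl ` P :: ('a + nat) set)"
  define r where "r i j \<longleftrightarrow> (\<exists>p q. i = Inl p \<and> j = Inl q \<and> p \<in> P \<and> q \<in> P \<and> p \<sqsubseteq>\<^bsub>D\<^esub> q)"
    for i j :: "'a + nat"
  have PD: "p \<in> carrier D" "join_irreducible D p" "p \<noteq> \<top>\<^bsub>D\<^esub>" if "p \<in> P" for p
    using that by (auto simp: P_def J_def join_irreducible_def)
  have PI: "p \<in> P" if "join_irreducible D p" "p \<noteq> \<top>\<^bsub>D\<^esub>" for p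
    using that by (simp add: P_def J_def)
  have finP: "finite P"
    using PD(1) D.finite_carrier by (meson finite_subset subsetI)
  define U where "U = (Inr ` {0, 1, 2} :: ('a + nat) set)"
  interpret colored_lattice Q U r
  proof
    show "3 \<le> card U"
      by (simp add: U_def card_image)
    show "r i k" if "r i j" "r j k" for i j k
      using that D.le_trans[OF _ _ PD(1) PD(1) PD(1)] unfolding r_def by blast
  qed (use finP PD(1) in \<open>auto simp: Q_def U_def r_def\<close>)
  define K where "K d = (Inl ` {p \<in> P. p \<sqsubseteq>\<^bsub>D\<^esub> d} :: ('a + nat) set)" for d
  \<comment> \<open>This is the Birkhoff map except at the unit, where \<open>K\<close> yields all
    of \<open>Q\<close> and \<open>theta Q\<close> is not total.\<close>
  define f where "f d = (if d = \<top>\<^bsub>D\<^esub> then carrier F \<times> carrier F else theta (K d))" for d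
  have K: "downset (K d)" if "d \<in> carrier D" for d
    unfolding downset_def
  proof (intro conjI allI impI)
    fix i j assume "r i j" "j \<in> K d"
    then obtain p q where pq: "i = Inl p" "p \<in> P" "q \<in> P" "p \<sqsubseteq>\<^bsub>D\<^esub> q" "q \<sqsubseteq>\<^bsub>D\<^esub> d"
      by (auto simp: r_def K_def)
    then show "i \<in> K d"
      using D.le_trans[OF pq(4,5) PD(1)[OF pq(2)] PD(1)[OF pq(3)] that] by (simp add: K_def)
  qed (auto simp: K_def Q_def)
  have K_below: "{i. r i (Inl p)} = K p" if "p \<in> P" for p
    using that by (auto simp: r_def K_def)
  \<comment> \<open>The unit is excluded as \<open>d\<close>: the join of \<open>P\<close> has the
    same \<open>K\<close>, but differs from the unit because the latter is join-irreducible.\<close>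
  have K_subset: "K d \<subseteq> K e \<longleftrightarrow> d \<sqsubseteq>\<^bsub>D\<^esub> e"
    if de: "d \<in> carrier D" "e \<in> carrier D" "d \<noteq> \<top>\<^bsub>D\<^esub>" for d e
  proof
    assume sub: "K d \<subseteq> K e"
    show "d \<sqsubseteq>\<^bsub>D\<^esub> e"
    proof (rule ccontr)
      assume "\<not> d \<sqsubseteq>\<^bsub>D\<^esub> e"
      then obtain p where p: "join_irreducible D p" "p \<sqsubseteq>\<^bsub>D\<^esub> d" "\<not> p \<sqsubseteq>\<^bsub>D\<^esub> e"
        using D.join_irreducible_separates[OF de(1,2)] by metis
      moreover have "p \<noteq> \<top>\<^bsub>D\<^esub>"
        using p(2) de D.top_higher[OF de(1)] D.le_antisym[of d "\<top>\<^bsub>D\<^esub>"] by auto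
      ultimately show False
        using PI[OF p(1)] sub p(2,3) by (auto simp: K_def inj_image_subset_iff)
    qed
  next
    assume "d \<sqsubseteq>\<^bsub>D\<^esub> e"
    then show "K d \<subseteq> K e"
      using D.le_trans[OF _ _ PD(1) de(1,2)] by (auto simp: K_def)
  qed
  have top_le: "\<top>\<^bsub>D\<^esub> \<sqsubseteq>\<^bsub>D\<^esub> e \<longleftrightarrow> e = \<top>\<^bsub>D\<^esub>" if "e \<in> carrier D" for e
    using that D.le_antisym[of e "\<top>\<^bsub>D\<^esub>"] D.top_higher by auto
  have le: "f d \<subseteq> f e \<longleftrightarrow> d \<sqsubseteq>\<^bsub>D\<^esub> e" if "d \<in> carrier D" "e \<in> carrier D" for d e
  proof -
    have "theta I \<subseteq> carrier F \<times> carrier F" for I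
      by (auto simp: theta_def)
    moreover have "K d \<subseteq> Q"
      using K[OF that(1)] by (simp add: downset_def)
    ultimately show ?thesis
      using that K_subset[OF that] top_le[OF that(2)] theta_not_total[of "K e"] theta_subset_iff[of "K d" "K e"]
      by (auto simp: f_def D.top_higher)
  qed
  have bij: "bij_betw f (carrier D) (carrier (Con F))"
    unfolding bij_betw_def
  proof
    show "inj_on f (carrier D)"
    proof (rule inj_onI)
      fix d e assume "d \<in> carrier D" "e \<in> carrier D" "f d = f e"
      then show "d = e"
        using le[of d e] le[of e d] by (intro D.le_antisym) auto
    qed
    show "f ` carrier D = carrier (Con F)"
    proof (intro equalityI subsetI)
      fix \<phi> assume "\<phi> \<in> f ` carrier D"
      then show "\<phi> \<in> carrier (Con F)"
        using congruence_theta[OF K] F.congruence_total by (auto simp: Con_def f_def)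
    next
      fix \<phi> assume "\<phi> \<in> carrier (Con F)"
      then have "congruence F \<phi>"
        by (simp add: Con_def)
      then consider "\<phi> = carrier F \<times> carrier F" | I where "downset I" "\<phi> = theta I"
        using cong_cases by blast
      then show "\<phi> \<in> f ` carrier D"
      proof cases
        case 1
        then show ?thesis
          by (intro image_eqI[of _ _ "\<top>\<^bsub>D\<^esub>"]) (simp_all add: f_def)
      next
        case 2
        let ?I = "{p \<in> P. Inl p \<in> I}"
        obtain d where d: "d \<in> carrier D"
          "\<And>q. join_irreducible D q \<Longrightarrow> q \<sqsubseteq>\<^bsub>D\<^esub> d \<longleftrightarrow> (\<exists>p\<in>?I. q \<sqsubseteq>\<^bsub>D\<^esub> p)"
          using D.join_of_join_irreducibles[of ?I] finP PD(2) by auto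
        \<comment> \<open>If \<open>d\<close> were the unit, join-irreducibility of the unit would
          put it below some \<open>p\<close> in \<open>P\<close>, forcing \<open>p\<close> to be the
          unit.\<close>
        have d_top: "d \<noteq> \<top>\<^bsub>D\<^esub>"
          using d(2)[OF assms(2)] top_le PD(1,3) by auto
        have mem: "Inl p \<in> I \<longleftrightarrow> p \<sqsubseteq>\<^bsub>D\<^esub> d" if "p \<in> P" for p
          using d(2)[OF PD(2)[OF that]] that PD(1)[OF that] 2(1)
          unfolding downset_def r_def by (metis (no_types, lifting) D.le_refl mem_Collect_eq)
        have "I \<subseteq> Inl ` P"
          using 2(1) unfolding downset_def by (simp add: Q_def)
        then have "I = Inl ` ?I"
          by blast
        also have "?I = {p \<in> P. p \<sqsubseteq>\<^bsub>D\<^esub> d}"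
          by (rule Collect_cong) (use mem in metis)
        finally have "I = K d"
          unfolding K_def .
        then show ?thesis
          using d(1) d_top 2(2) by (auto simp: f_def)
      qed
    qed
  qed
  have f_single: "f p = con F (single (Inl p) 1) (single (Inl p) 2)" if "p \<in> P" for p
    using that con_single[of "Inl p"] K_below[OF that] PD(3)[OF that] by (simp add: f_def Q_def)
  have J_plus: "J_plus D = {\<bottom>\<^bsub>D\<^esub>, \<top>\<^bsub>D\<^esub>} \<union> P"
    using assms(2) by (auto simp: J_plus_def P_def J_def)
  have "\<bottom>\<^bsub>D\<^esub> \<noteq> \<top>\<^bsub>D\<^esub>"
    using assms(2) by (auto simp: join_irreducible_def)
  moreover have "K \<bottom>\<^bsub>D\<^esub> = {}"
    using PD D.le_antisym D.bottom_lower by (auto simp: K_def join_irreducible_def)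
  ultimately have f_bottom: "f \<bottom>\<^bsub>D\<^esub> = theta {}"
    by (simp add: f_def)
  have f_top: "f \<top>\<^bsub>D\<^esub> = carrier F \<times> carrier F"
    by (simp add: f_def)
  \<comment> \<open>Zero, unit and the elements of \<open>P\<close> match the principal congruences
    from \<open>con_refl\<close>, \<open>con_null_full\<close> and \<open>con_single\<close>;
    \<open>con_cases\<close> shows that there are no others.\<close>
  have "f ` J_plus D = Princ F"
  proof (intro equalityI subsetI)
    fix \<phi> assume "\<phi> \<in> f ` J_plus D"
    then consider "\<phi> = theta {}" | "\<phi> = carrier F \<times> carrier F" | p where "p \<in> P" "\<phi> = f p"
      unfolding J_plus using f_bottom f_top by blast
    then show "\<phi> \<in> Princ F"
    proof cases
      case 1
      then show ?thesis
        unfolding Princ_def using con_refl[OF null_carrier] null_carrier by blast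
    next
      case 2
      then show ?thesis
        unfolding Princ_def using con_null_full null_carrier full_carrier by blast
    next
      case 3
      then have "Inl p \<in> Q" by (simp add: Q_def)
      then have "single (Inl p) 1 \<in> carrier F" "single (Inl p) 2 \<in> carrier F"
        by simp_all
      then show ?thesis
        unfolding Princ_def using 3 f_single by blast
    qed
  next
    fix \<phi> assume "\<phi> \<in> Princ F"
    then obtain x y where xy: "x \<in> carrier F" "y \<in> carrier F" "\<phi> = con F x y"
      by (auto simp: Princ_def)
    show "\<phi> \<in> f ` J_plus D"
    proof (cases "x = y")
      case True
      then show ?thesis
        using xy con_refl f_bottom by (auto simp: J_plus)
    next
      case False
      from con_cases[OF xy(1,2) this] show ?thesis
      proof
        assume "con F x y = carrier F \<times> carrier F"
        then show ?thesis
          using xy(3) f_top by (auto simp: J_plus)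
      next
        assume "\<exists>p\<in>Q. con F x y = theta {i. r i p}"
        then obtain p where "p \<in> P" "\<phi> = theta (K p)"
          using xy(3) K_below by (auto simp: Q_def)
        then have "\<phi> = f p"
          using PD(3) by (auto simp: f_def)
        then show ?thesis
          using \<open>p \<in> P\<close> by (auto simp: J_plus)
      qed
    qed
  qed
  moreover have "J_plus D \<subseteq> carrier D"
    using PD(1) by (auto simp: J_plus)
  ultimately show ?thesis
    using principal_congruence_representableI[OF F.finite_lattice_axioms D.lattice_axioms bij le] by blast
qed

end
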